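(* Let $\mathbf{s}=(s_1,\ldots,s_d)$ be an increasing (not necessarily strictly) sequence of positive integers such that for every $1\le i\le d-1$ there is some $k_i\in\mathbb{Z}_{>0}$ with $s_{i+1}=k_is_i$. Then $\mathbf{P}_d^{(\mathbf{s})}$ admits a unimodular triangulation.
   Context: For a sequence of positive integers $\mathbf{s}=(s_1,\ldots,s_d)$, the $\mathbf{s}$-lecture hall polytope is $\mathbf{P}_d^{(\mathbf{s})}=\{\mathbf{x}\in\mathbb{R}^d : 0\le \frac{x_1}{s_1}\le\frac{x_2}{s_2}\le\cdots\le\frac{x_d}{s_d}\le 1\}$, a $d$-dimensional lattice polytope. A triangulation of a $d$-dimensional lattice polytope $\mathcal{P}$ is a subdivision of $\mathcal{P}$ into $d$-dimensional lattice simplices (any two meeting in a common, possibly empty, face). It is unimodular if each of its $d$-simplices $\Delta$ is unimodularly equivalent to the standard $d$-simplex (image under $\mathbf{v}\mapsto\mathbf{v}U+\mathbf{w}$ with $U\in\mathbb{Z}^{d\times d}$, $\det U=\pm1$, $\mathbf{w}\in\mathbb{Z}^d$), equivalently each has normalized volume $1$. *)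

theory Defs
  imports "HOL-Analysis.Analysis"
begin

text \<open>
  Euclidean space of dimension \<open>d \<ge> 1\<close> is \<^typ>\<open>real ^ 'd\<close> with \<open>d = CARD('d)\<close>.  The linear order
  on the finite index type \<open>'d\<close> plays the role of \<open>1 < \<dots> < d\<close>, so that a sequence
  \<open>(s\<^sub>1, \<dots>, s\<^sub>d)\<close> is a function on \<open>'d\<close>, and \<open>j\<close> is the successor of \<open>i\<close> iff
  \<open>i < j\<close> and no index lies strictly between them.
\<close>

text \<open>
  Monotonicity of \<open>i \<mapsto> x\<^sub>i / s\<^sub>i\<close> is the chain of inequalities between consecutive indices; the
  bounds, stated for every index, amount to those at the two ends of the chain.
\<close>

definition lecture_hall_polytope :: "('d::{finite,linorder} \<Rightarrow> nat) \<Rightarrow> (real ^ 'd::{finite,linorder}) set" where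
  "lecture_hall_polytope s =
     {x. (\<forall>i. 0 \<le> x $ i / real (s i)) \<and>
         (\<forall>i j. i \<le> j \<longrightarrow> x $ i / real (s i) \<le> x $ j / real (s j)) \<and>
         (\<forall>i. x $ i / real (s i) \<le> 1)}"

definition integer_lattice :: "(real ^ 'd::finite) set" where
  "integer_lattice = {x. \<forall>i. x $ i \<in> \<int>}"

text \<open>Full-dimensional lattice simplices; the vertices are the extreme points.\<close>

definition lattice_simplex :: "(real ^ 'd::finite) set \<Rightarrow> bool" where
  "lattice_simplex \<Delta> \<longleftrightarrow>
     int CARD('d) simplex \<Delta> \<and> (\<forall>v. v extreme_point_of \<Delta> \<longrightarrow> v \<in> integer_lattice)"

text \<open>
  The library predicate \<^const>\<open>triangulation\<close> requires a finite family of simplices (of arbitrary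
  dimension) any two of which meet in a common, possibly empty, face; it does not mention the set
  being triangulated.
\<close>

definition lattice_triangulation :: "(real ^ 'd::finite) set set \<Rightarrow> (real ^ 'd) set \<Rightarrow> bool" where
  "lattice_triangulation \<T> P \<longleftrightarrow>
     triangulation \<T> \<and> (\<forall>\<Delta>\<in>\<T>. lattice_simplex \<Delta>) \<and> \<Union>\<T> = P"

definition standard_simplex :: "(real ^ 'd::finite) set" where
  "standard_simplex = convex hull (insert 0 Basis)"

definition unimodularly_equivalent ::
    "(real ^ 'd::finite) set \<Rightarrow> (real ^ 'd) set \<Rightarrow> bool" where
  "unimodularly_equivalent P Q \<longleftrightarrow>
     (\<exists>(U :: int ^ 'd ^ 'd) (w :: int ^ 'd). (det U = 1 \<or> det U = - 1) \<and>
        P = (\<lambda>v. v v* map_matrix real_of_int U + (\<chi> i. real_of_int (w $ i))) ` Q)"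

definition unimodular_triangulation ::
    "(real ^ 'd::finite) set set \<Rightarrow> (real ^ 'd) set \<Rightarrow> bool" where
  "unimodular_triangulation \<T> P \<longleftrightarrow>
     lattice_triangulation \<T> P \<and> (\<forall>\<Delta>\<in>\<T>. unimodularly_equivalent \<Delta> standard_simplex)"

end

theory Submission
  imports Defs
begin

text \<open>
  If \<open>s\<^sub>d = k s\<^bsub>d-1\<^esub>\<close>, the polytope is the region between the graphs of the integral affine functions
  \<open>k x\<^bsub>d-1\<^esub>\<close> and \<open>s\<^sub>d\<close> over the polytope of \<open>(s\<^sub>1, \<dots>, s\<^bsub>d-1\<^esub>)\<close>.  A unimodular triangulation
  of a base lifts to such a region: over a simplex with all vertices placed on the lower graph, raise
  the vertices to the upper graph one after the other, in unit steps and in a fixed order of all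
  vertices of the triangulation; each unit step sweeps out one unimodular simplex.  The common order
  makes the simplices over neighbouring base simplices fit together.
\<close>

text \<open>No geometric simplex occurs during the lifting. A stage is a family of vertex sets for
  which every point of the region has exactly one system of barycentric coordinates supported on a
  member. Existence is covering; uniqueness, demanded across different members, forces two simplices
  to meet only in the hull of their common vertices. Convex hulls are taken once, after the last
  stage. Every stage sits in the full space, with the coordinates outside an index set
  \<open>A\<close> equal to zero, so that the induction runs over \<open>A\<close> while the type
  stays fixed. Divisibility makes the slope of the lower graph an integer, so that both graphs pass
  through lattice points over each lattice point of the base. A vertex at which the two graphs meet
  has no step to make. Cells still exist over every base simplex: if the graphs met at all of its
  vertices, affinity would make them agree over the whole base lattice, but over the origin their
  heights are 0 and the new entry of \<open>s\<close>, which is positive.\<close>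

definition coord_lattice :: "'d::finite set \<Rightarrow> (real ^ 'd) set" where
  "coord_lattice A = {x \<in> integer_lattice. \<forall>i. i \<notin> A \<longrightarrow> x $ i = 0}"

text \<open>The sums run over all vertices and the support condition makes \<open>c\<close> vanish
  off a single member, so coordinates coming from different members can be compared as
  functions.\<close>

definition barycentric :: "'v::real_vector set set \<Rightarrow> 'v \<Rightarrow> ('v \<Rightarrow> real) \<Rightarrow> bool" where
  "barycentric T x c \<longleftrightarrow>
     (\<forall>v. 0 \<le> c v) \<and> (\<exists>\<sigma>\<in>T. \<forall>v. c v \<noteq> 0 \<longrightarrow> v \<in> \<sigma>) \<and>
     sum c (\<Union>T) = 1 \<and> (\<Sum>v\<in>\<Union>T. c v *\<^sub>R v) = x"

text \<open>For \<open>card A + 1\<close> points, integral affine spanning contains both affine independence and unimodularity.\<close>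

definition integral_affine_spanning :: "'v::real_vector set \<Rightarrow> 'v set \<Rightarrow> bool" where
  "integral_affine_spanning \<sigma> L \<longleftrightarrow>
     (\<forall>z\<in>L. \<exists>c. (\<forall>v. c v \<in> \<int>) \<and> sum c \<sigma> = 1 \<and> (\<Sum>v\<in>\<sigma>. c v *\<^sub>R v) = z)"

definition unimodular_complex ::
    "'d::finite set \<Rightarrow> (real ^ 'd) set set \<Rightarrow> (real ^ 'd) set \<Rightarrow> bool" where
  "unimodular_complex A T P \<longleftrightarrow>
     finite T \<and>
     (\<forall>\<sigma>\<in>T. finite \<sigma> \<and> card \<sigma> = Suc (card A) \<and> \<sigma> \<subseteq> coord_lattice A \<and>
             integral_affine_spanning \<sigma> (coord_lattice A)) \<and>
     (\<forall>x. x \<in> P \<longleftrightarrow> (\<exists>c. barycentric T x c)) \<and>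
     (\<forall>x c c'. barycentric T x c \<longrightarrow> barycentric T x c' \<longrightarrow> c = c')"

lemma barycentric_extend:
  assumes "finite (\<Union>T)" "\<sigma> \<in> T" "\<And>v. v \<in> \<sigma> \<Longrightarrow> 0 \<le> c v"
    and "sum c \<sigma> = 1" "(\<Sum>v\<in>\<sigma>. c v *\<^sub>R v) = x"
  shows "barycentric T x (\<lambda>v. if v \<in> \<sigma> then c v else 0)"
proof -
  let ?c = "\<lambda>v. if v \<in> \<sigma> then c v else 0"
  have sub: "\<sigma> \<subseteq> \<Union>T" using assms(2) by auto
  have "sum ?c (\<Union>T) = sum c \<sigma>"
    by (rule sum.mono_neutral_cong_right) (use assms(1) sub in auto)
  moreover have "(\<Sum>v\<in>\<Union>T. ?c v *\<^sub>R v) = (\<Sum>v\<in>\<sigma>. c v *\<^sub>R v)"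
    by (rule sum.mono_neutral_cong_right) (use assms(1) sub in auto)
  ultimately show ?thesis
    using assms unfolding barycentric_def by auto
qed

lemma barycentric_restrict:
  assumes "finite (\<Union>T)" "\<sigma> \<in> T" "barycentric T x c" "\<And>v. c v \<noteq> 0 \<Longrightarrow> v \<in> \<sigma>"
  shows "sum c \<sigma> = 1" "(\<Sum>v\<in>\<sigma>. c v *\<^sub>R v) = x"
proof -
  have sub: "\<sigma> \<subseteq> \<Union>T" using assms(2) by auto
  have "sum c (\<Union>T) = sum c \<sigma>"
    by (rule sum.mono_neutral_right) (use assms sub in auto)
  then show "sum c \<sigma> = 1" using assms(3) by (auto simp: barycentric_def)
  have "(\<Sum>v\<in>\<Union>T. c v *\<^sub>R v) = (\<Sum>v\<in>\<sigma>. c v *\<^sub>R v)"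
    by (rule sum.mono_neutral_right) (use assms sub in auto)
  then show "(\<Sum>v\<in>\<sigma>. c v *\<^sub>R v) = x" using assms(3) by (auto simp: barycentric_def)
qed

subsection \<open>Nonnegative weights on finite chains\<close>

text \<open>Intervals of lengths \<open>a v\<close>, laid end to end in the order of
  \<open>\<rho>\<close>, fill the segment from 0 to \<open>sum a V\<close>; \<open>w\<close> owns an
  interval containing \<open>t\<close>. Inserting elements by increasing rank leaves the earlier
  intervals in place. Lengths may be zero, so both inequalities are weak.\<close>

lemma partial_sum_bracket:
  fixes a :: "'a \<Rightarrow> real" and \<rho> :: "'a \<Rightarrow> 'b::linorder"
  assumes "finite V" "V \<noteq> {}" "inj_on \<rho> V" "\<And>v. v \<in> V \<Longrightarrow> 0 \<le> a v" "0 \<le> t" "t \<le> sum a V"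
  shows "\<exists>w\<in>V. sum a {v\<in>V. \<rho> v < \<rho> w} \<le> t \<and> t \<le> sum a {v\<in>V. \<rho> v < \<rho> w} + a w"
  using assms
proof (induction V rule: finite_ranking_induct[where f = \<rho>])
  case empty
  then show ?case by simp
next
  case (insert x S)
  show ?case
  proof (cases "x \<in> S")
    case True
    then have S: "insert x S = S" by auto
    show ?thesis
      unfolding S by (rule insert.IH) (use insert.prems True in \<open>auto simp: S\<close>)
  next
    case x: False
    have less: "\<rho> y < \<rho> x" if "y \<in> S" for y
      using insert.hyps(2)[OF that] inj_onD[OF insert.prems(2), of y x] that x by force
    have eq: "{v \<in> insert x S. \<rho> v < \<rho> w} = {v \<in> S. \<rho> v < \<rho> w}" if "w \<in> S" for w
      using less[OF that] by auto
    have eqx: "{v \<in> insert x S. \<rho> v < \<rho> x} = S" using less by auto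
    show ?thesis
    proof (cases "S \<noteq> {} \<and> t \<le> sum a S")
      case True
      then have "\<exists>w\<in>S. sum a {v\<in>S. \<rho> v < \<rho> w} \<le> t \<and> t \<le> sum a {v\<in>S. \<rho> v < \<rho> w} + a w"
        using insert by (intro insert.IH) auto
      then show ?thesis using eq by auto
    next
      case False
      then have "sum a S \<le> t" using insert.prems by auto
      then show ?thesis using eqx insert.hyps insert.prems x by (intro bexI[of _ x]) (auto simp: add.commute)
    qed
  qed
qed

text \<open>\<open>H\<close> is full (equal to \<open>a\<close>) before \<open>w\<close> and empty
  after it, and likewise \<open>H'\<close> for \<open>w'\<close>. For equal thresholds the two
  differ at most at \<open>w\<close>, and the total settles that value. If \<open>w\<close> comes
  strictly before \<open>w'\<close>, then \<open>H \<le> H'\<close> pointwise, since each element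
  has \<open>H'\<close> full or \<open>H\<close> empty; equal totals then force equality.\<close>

lemma threshold_unique_aux:
  fixes H H' a :: "'a \<Rightarrow> real" and \<rho> :: "'a \<Rightarrow> 'b::linorder"
  assumes V: "finite V" "inj_on \<rho> V" and w: "w \<in> V" "w' \<in> V" "\<rho> w \<le> \<rho> w'"
    and b: "\<And>v. v \<in> V \<Longrightarrow> H v \<le> a v" "\<And>v. v \<in> V \<Longrightarrow> 0 \<le> H' v"
    and H: "\<And>v. v \<in> V \<Longrightarrow> \<rho> v < \<rho> w \<Longrightarrow> H v = a v" "\<And>v. v \<in> V \<Longrightarrow> \<rho> w < \<rho> v \<Longrightarrow> H v = 0"
    and H': "\<And>v. v \<in> V \<Longrightarrow> \<rho> v < \<rho> w' \<Longrightarrow> H' v = a v" "\<And>v. v \<in> V \<Longrightarrow> \<rho> w' < \<rho> v \<Longrightarrow> H' v = 0"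
    and eq: "sum H V = sum H' V" and v: "v \<in> V"
  shows "H v = H' v"
proof (cases "w = w'")
  case True
  have ne: "H x = H' x" if "x \<in> V - {w}" for x
    using that H H' True V(2) w by (metis DiffE inj_on_eq_iff insertI1 linorder_neqE)
  have "sum H (V - {w}) = sum H' (V - {w})" using ne by (intro sum.cong) auto
  then have "H w = H' w" using eq V w by (simp add: sum.remove)
  then show ?thesis using ne v by auto
next
  case False
  then have lt: "\<rho> w < \<rho> w'" using w V by (metis inj_on_eq_iff order_le_less)
  have le: "H x \<le> H' x" if "x \<in> V" for x
  proof (cases "\<rho> x < \<rho> w'")
    case True
    then show ?thesis using b H' that by auto
  next
    case False
    then show ?thesis using b(2) H(2) lt that by auto
  qed
  have "sum (\<lambda>x. H' x - H x) V = 0" using eq by (simp add: sum_subtractf)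
  then have "H' v - H v = 0" using le V v by (subst (asm) sum_nonneg_eq_0_iff) auto
  then show ?thesis by simp
qed

lemma threshold_unique:
  fixes H H' a :: "'a \<Rightarrow> real" and \<rho> :: "'a \<Rightarrow> 'b::linorder"
  assumes "finite V" "inj_on \<rho> V" "w \<in> V" "w' \<in> V"
    and "\<And>v. v \<in> V \<Longrightarrow> 0 \<le> H v" "\<And>v. v \<in> V \<Longrightarrow> H v \<le> a v"
    and "\<And>v. v \<in> V \<Longrightarrow> 0 \<le> H' v" "\<And>v. v \<in> V \<Longrightarrow> H' v \<le> a v"
    and "\<And>v. v \<in> V \<Longrightarrow> \<rho> v < \<rho> w \<Longrightarrow> H v = a v" "\<And>v. v \<in> V \<Longrightarrow> \<rho> w < \<rho> v \<Longrightarrow> H v = 0"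
    and "\<And>v. v \<in> V \<Longrightarrow> \<rho> v < \<rho> w' \<Longrightarrow> H' v = a v" "\<And>v. v \<in> V \<Longrightarrow> \<rho> w' < \<rho> v \<Longrightarrow> H' v = 0"
    and "sum H V = sum H' V" "v \<in> V"
  shows "H v = H' v"
proof (cases "\<rho> w \<le> \<rho> w'")
  case True
  show ?thesis
    by (rule threshold_unique_aux[OF assms(1,2,3,4) True, of H a H']) (use assms in auto)
next
  case False
  have "H' v = H v"
    by (rule threshold_unique_aux[OF assms(1,2,4,3), of H' a H]) (use assms False in auto)
  then show ?thesis by simp
qed

lemma consecutive_unique_same:
  fixes f g :: "int \<Rightarrow> real"
  assumes I: "finite I"
    and f: "\<And>k. k \<in> I \<Longrightarrow> f k \<noteq> 0 \<Longrightarrow> k = m \<or> k = m + 1"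
    and g: "\<And>k. k \<in> I \<Longrightarrow> g k \<noteq> 0 \<Longrightarrow> k = m \<or> k = m + 1"
    and s0: "sum f I = sum g I"
    and s1: "(\<Sum>k\<in>I. f k * of_int k) = (\<Sum>k\<in>I. g k * of_int k)"
    and k: "k \<in> I"
  shows "f k = g k"
proof -
  define d where "d k = f k - g k" for k
  have d: "k = m \<or> k = m + 1" if "k \<in> I" "d k \<noteq> 0" for k
    using f g that unfolding d_def by force
  have t0: "sum d I = 0" unfolding d_def using s0 by (simp add: sum_subtractf)
  have t1: "(\<Sum>k\<in>I. d k * of_int k) = 0"
    unfolding d_def using s1 by (simp add: sum_subtractf left_diff_distrib)
  \<comment> \<open>Taking the moment about \<open>m\<close> removes the weight at \<open>m\<close>
    and isolates the one at \<open>m + 1\<close>.\<close>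
  have "(\<Sum>k\<in>I. d k * of_int (k - m)) = 0"
    using t0 t1 by (simp add: sum_subtractf right_diff_distrib flip: sum_distrib_right)
  moreover have "(\<Sum>k\<in>I. d k * of_int (k - m)) = (\<Sum>k\<in>I. if k = m + 1 then d k else 0)"
    using d by (intro sum.cong) auto
  ultimately have a: "k \<in> I \<Longrightarrow> k = m + 1 \<Longrightarrow> d k = 0" for k
    using I by (auto simp: sum.delta)
  have "sum d I = (\<Sum>k\<in>I. if k = m then d k else 0)"
    using d a by (intro sum.cong) auto
  then have "k \<in> I \<Longrightarrow> k = m \<Longrightarrow> d k = 0" for k
    using I t0 by (auto simp: sum.delta)
  then have "d k = 0" using a d k by blast
  then show ?thesis by (simp add: d_def)
qed

text \<open>About \<open>m + 1\<close>, the moment of \<open>f\<close> is at most 0 and that of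
  \<open>g\<close> is at least 0, because \<open>n \<ge> m + 1\<close>. The moments agree, so both
  vanish and both weights are concentrated at \<open>m + 1\<close>, which leaves the case of a
  common pair of heights.\<close>

lemma consecutive_unique_less:
  fixes f g :: "int \<Rightarrow> real"
  assumes I: "finite I" and "m < n"
    and pos: "\<And>k. k \<in> I \<Longrightarrow> 0 \<le> f k" "\<And>k. k \<in> I \<Longrightarrow> 0 \<le> g k"
    and f: "\<And>k. k \<in> I \<Longrightarrow> f k \<noteq> 0 \<Longrightarrow> k = m \<or> k = m + 1"
    and g: "\<And>k. k \<in> I \<Longrightarrow> g k \<noteq> 0 \<Longrightarrow> k = n \<or> k = n + 1"
    and s0: "sum f I = sum g I"
    and s1: "(\<Sum>k\<in>I. f k * of_int k) = (\<Sum>k\<in>I. g k * of_int k)"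
    and k: "k \<in> I"
  shows "f k = g k"
proof -
  let ?F = "\<lambda>k. f k * (of_int (m + 1) - of_int k)"
  let ?G = "\<lambda>k. g k * (of_int k - of_int (m + 1))"
  have F: "0 \<le> ?F k" if "k \<in> I" for k
    using pos(1)[OF that] f[OF that] by (cases "f k = 0") auto
  have G: "0 \<le> ?G k" if "k \<in> I" for k
    using pos(2)[OF that] g[OF that] \<open>m < n\<close> by (cases "g k = 0") (auto intro!: mult_nonneg_nonneg)
  have "sum ?F I + sum ?G I = 0"
    using s0 s1 by (simp add: right_diff_distrib sum_subtractf flip: sum_distrib_right)
  moreover have "0 \<le> sum ?F I" "0 \<le> sum ?G I" using F G by (auto intro: sum_nonneg)
  ultimately have "sum ?F I = 0" "sum ?G I = 0" by linarith+
  then have F0: "?F k = 0" and G0: "?G k = 0" if "k \<in> I" for k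
    using F G I that sum_nonneg_eq_0_iff[of I ?F] sum_nonneg_eq_0_iff[of I ?G] by auto
  have F1: "k = m + 1" if "k \<in> I" "f k \<noteq> 0" for k
    using F0[OF that(1)] that(2) by auto
  have G1: "k = m + 1" if "k \<in> I" "g k \<noteq> 0" for k
    using G0[OF that(1)] that(2) by auto
  show ?thesis
    by (rule consecutive_unique_same[OF I _ _ s0 s1 k, of m]) (use F1 G1 in auto)
qed

lemma consecutive_unique:
  fixes f g :: "int \<Rightarrow> real"
  assumes "finite I"
    and "\<And>k. k \<in> I \<Longrightarrow> 0 \<le> f k" "\<And>k. k \<in> I \<Longrightarrow> 0 \<le> g k"
    and "\<And>k. k \<in> I \<Longrightarrow> f k \<noteq> 0 \<Longrightarrow> k = m \<or> k = m + 1"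
    and "\<And>k. k \<in> I \<Longrightarrow> g k \<noteq> 0 \<Longrightarrow> k = n \<or> k = n + 1"
    and "sum f I = sum g I"
    and "(\<Sum>k\<in>I. f k * of_int k) = (\<Sum>k\<in>I. g k * of_int k)"
    and "k \<in> I"
  shows "f k = g k"
proof (rule linorder_cases[of m n])
  assume "m < n"
  show ?thesis
    by (rule consecutive_unique_less[OF \<open>finite I\<close> \<open>m < n\<close>]) (use assms in auto)
next
  assume "m = n"
  show ?thesis
    by (rule consecutive_unique_same[OF \<open>finite I\<close>, of f m]) (use assms \<open>m = n\<close> in auto)
next
  assume "n < m"
  have "g k = f k"
    by (rule consecutive_unique_less[OF \<open>finite I\<close> \<open>n < m\<close>]) (use assms in auto)
  then show ?thesis by simp
qed

subsection \<open>From vertex sets to geometric simplices\<close>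

text \<open>The rows of \<open>U\<close> are the edge vectors from a vertex \<open>v0\<close>.
  Integral spanning writes each unit vector as an integer combination of these rows, which yields an
  integral \<open>C\<close> with \<open>C ** U = mat 1\<close>; hence \<open>det U\<close> divides
  1.\<close>

lemma unimodular_equivalent_convex_hull:
  fixes \<sigma> :: "(real ^ 'd::finite) set"
  assumes fin: "finite \<sigma>" and card: "card \<sigma> = Suc CARD('d)" and lat: "\<sigma> \<subseteq> integer_lattice"
    and span: "integral_affine_spanning \<sigma> integer_lattice"
  shows "unimodularly_equivalent (convex hull \<sigma>) standard_simplex"
proof -
  obtain v0 where v0: "v0 \<in> \<sigma>" using card by fastforce
  have "card (\<sigma> - {v0}) = card (UNIV :: 'd set)" using card v0 fin by simp
  then obtain h :: "'d \<Rightarrow> real ^ 'd" where h: "bij_betw h UNIV (\<sigma> - {v0})"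
    using fin by (metis finite_Diff finite_same_card_bij finite_class.finite_UNIV)
  have hin: "h i \<in> \<sigma>" for i using h by (auto simp: bij_betw_def)
  define w :: "int ^ 'd" where "w = (\<chi> j. \<lfloor>v0 $ j\<rfloor>)"
  define U :: "int ^ 'd ^ 'd" where "U = (\<chi> i j. \<lfloor>h i $ j - v0 $ j\<rfloor>)"
  have w: "real_of_int (w $ j) = v0 $ j" for j
  proof -
    have "v0 $ j \<in> \<int>" using v0 lat by (auto simp: integer_lattice_def)
    then show ?thesis by (auto simp: w_def elim: Ints_cases)
  qed
  have U: "real_of_int (U $ i $ j) = h i $ j - v0 $ j" for i j
  proof -
    have "h i $ j - v0 $ j \<in> \<int>"
      using v0 lat hin[of i] by (intro Ints_diff) (auto simp: integer_lattice_def)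
    then show ?thesis by (auto simp: U_def elim: Ints_cases)
  qed
  \<comment> \<open>Shifting by \<open>v0\<close> turns an affine combination with sum 1 into a
    linear combination of the edge vectors that equals \<open>axis i 1\<close>.\<close>
  have "\<exists>c. (\<forall>v. c v \<in> \<int>) \<and> sum c \<sigma> = 1 \<and> (\<Sum>v\<in>\<sigma>. c v *\<^sub>R v) = axis i 1 + v0" for i
  proof -
    have "axis i 1 + v0 \<in> integer_lattice"
      using v0 lat by (auto simp: integer_lattice_def axis_def)
    then show ?thesis using span by (auto simp: integral_affine_spanning_def)
  qed
  then obtain c where c: "\<And>i v. c i v \<in> \<int>" "\<And>i. sum (c i) \<sigma> = 1"
    "\<And>i. (\<Sum>v\<in>\<sigma>. c i v *\<^sub>R v) = axis i 1 + v0" by metis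
  define C :: "int ^ 'd ^ 'd" where "C = (\<chi> i j. \<lfloor>c i (h j)\<rfloor>)"
  have C: "real_of_int (C $ i $ j) = c i (h j)" for i j
    using c(1)[of i "h j"] by (auto simp: C_def elim: Ints_cases)
  have "(\<Sum>j\<in>UNIV. c i (h j) * (h j $ k - v0 $ k)) = axis i 1 $ k" for i k
  proof -
    have "(\<Sum>j\<in>UNIV. c i (h j) * (h j $ k - v0 $ k)) = (\<Sum>v\<in>\<sigma> - {v0}. c i v * (v $ k - v0 $ k))"
      using sum.reindex_bij_betw[OF h] by fast
    also have "\<dots> = (\<Sum>v\<in>\<sigma>. c i v * (v $ k - v0 $ k))"
      using fin v0 by (simp add: sum.remove[of \<sigma> v0])
    also have "\<dots> = (\<Sum>v\<in>\<sigma>. c i v *\<^sub>R v) $ k - sum (c i) \<sigma> * v0 $ k"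
      by (simp add: right_diff_distrib sum_subtractf sum_distrib_right)
    finally show ?thesis using c by simp
  qed
  then have "real_of_int (\<Sum>j\<in>UNIV. C $ i $ j * U $ j $ k) = real_of_int (if i = k then 1 else 0)" for i k
    by (simp add: C U axis_def)
  then have "(\<Sum>j\<in>UNIV. C $ i $ j * U $ j $ k) = (if i = k then 1 else 0)" for i k
    using of_int_eq_iff by blast
  then have "C ** U = mat 1"
    by (simp add: matrix_matrix_mult_def mat_def vec_eq_iff)
  then have "det C * det U = 1" by (metis det_mul det_I)
  then have det: "det U = 1 \<or> det U = - 1"
    by (metis mult.commute zmult_eq_1_iff)
  let ?M = "\<lambda>v. v v* map_matrix real_of_int U"
  let ?w = "\<chi> i. real_of_int (w $ i)"
  have w': "?w = v0" by (simp add: w vec_eq_iff)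
  have M: "?M (axis i 1) = h i - v0" for i
    by (simp add: vec_eq_iff vector_matrix_mult_def axis_def map_matrix_def U if_distribR if_distrib[of "\<lambda>x. x * _"] sum.delta cong: if_cong)
  have lin: "linear ?M" by (simp add: linear_iff vector_matrix_left_distrib scaleR_vector_matrix_assoc)
  have "(\<lambda>v. ?M v + ?w) ` standard_simplex = (\<lambda>v. v0 + v) ` ?M ` (convex hull (insert 0 Basis))"
    by (simp add: standard_simplex_def image_image w' add.commute)
  also have "\<dots> = convex hull ((\<lambda>v. v0 + v) ` ?M ` insert 0 Basis)"
    by (simp only: convex_hull_linear_image[OF lin] convex_hull_translation)
  also have "(\<lambda>v. v0 + v) ` ?M ` insert 0 Basis = insert v0 (range h)"
  proof -
    have B: "(Basis :: (real ^ 'd) set) = range (\<lambda>i. axis i 1)"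
      by (auto simp: Basis_vec_def)
    have "(\<lambda>v. v0 + v) ` ?M ` range (\<lambda>i. axis i 1) = range h" by (auto simp: M image_image)
    moreover have "?M 0 = 0" using lin linear_0 by blast
    ultimately show ?thesis unfolding B by simp
  qed
  also have "insert v0 (range h) = \<sigma>" using h v0 by (auto simp: bij_betw_def)
  finally show ?thesis unfolding unimodularly_equivalent_def using det by metis
qed

text \<open>The affine hull contains 0 and the unit vectors, hence is the whole space; as many as
  \<open>CARD('d) + 1\<close> points spanning it leave no room for a dependence.\<close>

lemma affine_independent_if_integral_affine_spanning:
  fixes \<sigma> :: "(real ^ 'd::finite) set"
  assumes fin: "finite \<sigma>" and card: "card \<sigma> = Suc CARD('d)"
    and span: "integral_affine_spanning \<sigma> integer_lattice"
  shows "\<not> affine_dependent \<sigma>"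
proof -
  have "insert 0 Basis \<subseteq> affine hull \<sigma>"
  proof
    fix z :: "real ^ 'd" assume "z \<in> insert 0 Basis"
    then have "z \<in> integer_lattice" by (auto simp: integer_lattice_def Basis_vec_def axis_def)
    then show "z \<in> affine hull \<sigma>"
      using span fin by (auto simp: integral_affine_spanning_def affine_hull_finite)
  qed
  then have "affine hull (insert 0 Basis) \<subseteq> affine hull \<sigma>" by (simp add: hull_minimal)
  moreover have "affine hull (insert 0 Basis) = (UNIV :: (real ^ 'd) set)"
    by (simp add: affine_hull_span_0 hull_inc)
  ultimately have "affine hull \<sigma> = UNIV" by auto
  then have "aff_dim \<sigma> = int CARD('d)"
    by (metis aff_dim_affine_hull aff_dim_UNIV DIM_cart DIM_real mult.right_neutral)
  then show ?thesis using fin card by (simp add: affine_independent_iff_card)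
qed

lemma coord_lattice_UNIV: "coord_lattice UNIV = integer_lattice"
  by (simp add: coord_lattice_def)

lemma unimodular_triangulation_if_complex:
  fixes T :: "(real ^ 'd::finite) set set"
  assumes "unimodular_complex UNIV T P"
  shows "unimodular_triangulation ((hull) convex ` T) P"
proof -
  have T: "finite T"
    and \<sigma>: "\<And>\<sigma>. \<sigma> \<in> T \<Longrightarrow> finite \<sigma>" "\<And>\<sigma>. \<sigma> \<in> T \<Longrightarrow> card \<sigma> = Suc CARD('d)"
      "\<And>\<sigma>. \<sigma> \<in> T \<Longrightarrow> \<sigma> \<subseteq> integer_lattice"
      "\<And>\<sigma>. \<sigma> \<in> T \<Longrightarrow> integral_affine_spanning \<sigma> integer_lattice"
    and P: "\<And>x. x \<in> P \<longleftrightarrow> (\<exists>c. barycentric T x c)"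
    and uniq: "\<And>x c c'. barycentric T x c \<Longrightarrow> barycentric T x c' \<Longrightarrow> c = c'"
    using assms unfolding unimodular_complex_def coord_lattice_UNIV by blast+
  have fU: "finite (\<Union>T)" using T \<sigma> by auto
  have ind: "\<not> affine_dependent \<sigma>" if "\<sigma> \<in> T" for \<sigma>
    using affine_independent_if_integral_affine_spanning \<sigma> that by blast
  have hull: "\<exists>c. barycentric T x c \<and> (\<forall>v. c v \<noteq> 0 \<longrightarrow> v \<in> \<sigma>)"
    if s: "\<sigma> \<in> T" and x: "x \<in> convex hull \<sigma>" for \<sigma> x
  proof -
    obtain u where u: "\<forall>v\<in>\<sigma>. 0 \<le> u v" "sum u \<sigma> = 1" "(\<Sum>v\<in>\<sigma>. u v *\<^sub>R v) = x"
      using x convex_hull_finite[OF \<sigma>(1)[OF s]] by auto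
    have "barycentric T x (\<lambda>v. if v \<in> \<sigma> then u v else 0)"
      by (rule barycentric_extend[OF fU that(1)]) (use u in auto)
    then show ?thesis by (intro exI conjI) (auto split: if_splits)
  qed
  have hull': "x \<in> convex hull \<sigma>"
    if "\<sigma> \<in> T" and "barycentric T x c" and "\<And>v. c v \<noteq> 0 \<Longrightarrow> v \<in> \<sigma>" for \<sigma> x c
  proof -
    have "sum c \<sigma> = 1" "(\<Sum>v\<in>\<sigma>. c v *\<^sub>R v) = x" "\<forall>v\<in>\<sigma>. 0 \<le> c v"
      using barycentric_restrict[OF fU that] that(2) by (auto simp: barycentric_def)
    then show ?thesis using \<sigma>(1)[OF that(1)] by (auto simp: convex_hull_finite)
  qed
  \<comment> \<open>A common point has coordinates supported on \<open>\<sigma>\<close> and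
    coordinates supported on \<open>\<tau>\<close>. Uniqueness identifies them, so their support
    lies in both vertex sets. Hulls of subsets of an independent set are faces, which is how this
    becomes the face condition.\<close>
  have inter: "convex hull \<sigma> \<inter> convex hull \<tau> = convex hull (\<sigma> \<inter> \<tau>)" if "\<sigma> \<in> T" "\<tau> \<in> T" for \<sigma> \<tau>
  proof
    show "convex hull (\<sigma> \<inter> \<tau>) \<subseteq> convex hull \<sigma> \<inter> convex hull \<tau>"
      by (simp add: hull_mono)
    show "convex hull \<sigma> \<inter> convex hull \<tau> \<subseteq> convex hull (\<sigma> \<inter> \<tau>)"
    proof
      fix x assume "x \<in> convex hull \<sigma> \<inter> convex hull \<tau>"
      then have "x \<in> convex hull \<sigma>" "x \<in> convex hull \<tau>" by auto
      from hull[OF that(1) this(1)] hull[OF that(2) this(2)]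
      obtain c c' where c': "barycentric T x c" "barycentric T x c'"
        "\<forall>v. c v \<noteq> 0 \<longrightarrow> v \<in> \<sigma>" "\<forall>v. c' v \<noteq> 0 \<longrightarrow> v \<in> \<tau>" by blast
      then have c: "barycentric T x c" "\<And>v. c v \<noteq> 0 \<Longrightarrow> v \<in> \<sigma> \<inter> \<tau>"
        using uniq[OF c'(1,2)] by auto
      have r: "sum c \<sigma> = 1" "(\<Sum>v\<in>\<sigma>. c v *\<^sub>R v) = x"
        using barycentric_restrict[OF fU that(1) c(1)] c(2) by auto
      have "sum c (\<sigma> \<inter> \<tau>) = sum c \<sigma>"
        by (rule sum.mono_neutral_left) (use \<sigma>(1) that c in auto)
      moreover have "(\<Sum>v\<in>\<sigma> \<inter> \<tau>. c v *\<^sub>R v) = (\<Sum>v\<in>\<sigma>. c v *\<^sub>R v)"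
        by (rule sum.mono_neutral_left) (use \<sigma>(1) that c in auto)
      moreover have "\<forall>v. 0 \<le> c v" using c by (auto simp: barycentric_def)
      ultimately show "x \<in> convex hull (\<sigma> \<inter> \<tau>)"
        using r \<sigma>(1)[OF that(1)] by (auto simp: convex_hull_finite)
    qed
  qed
  have simplex: "int CARD('d) simplex (convex hull \<sigma>)" if "\<sigma> \<in> T" for \<sigma>
    unfolding Polytope.simplex using ind[OF that] \<sigma>(1,2)[OF that] by (intro exI[of _ \<sigma>]) auto
  have "triangulation ((hull) convex ` T)"
    unfolding triangulation_def
  proof (intro conjI ballI allI impI)
    show "finite ((hull) convex ` T)" using T by simp
  next
    fix \<Delta> assume "\<Delta> \<in> (hull) convex ` T"
    then show "\<exists>n. n simplex \<Delta>" using simplex by auto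
  next
    fix X Y assume "X \<in> (hull) convex ` T \<and> Y \<in> (hull) convex ` T"
    then obtain \<sigma> \<tau> where "\<sigma> \<in> T" "\<tau> \<in> T" and XY: "X = convex hull \<sigma>" "Y = convex hull \<tau>"
      by auto
    then show "X \<inter> Y face_of X"
      unfolding XY using ind inter[of \<sigma> \<tau>]
      by (auto simp: face_of_convex_hull_affine_independent)
  qed
  moreover have "lattice_simplex (convex hull \<sigma>)" if "\<sigma> \<in> T" for \<sigma>
    unfolding lattice_simplex_def using simplex[OF that] \<sigma>(3)[OF that]
    by (auto dest: extreme_point_of_convex_hull)
  moreover have "\<Union>((hull) convex ` T) = P"
  proof (intro set_eqI iffI)
    fix x assume "x \<in> \<Union>((hull) convex ` T)"
    then show "x \<in> P" using hull P by blast
  next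
    fix x assume "x \<in> P"
    then obtain c \<sigma> where "barycentric T x c" "\<sigma> \<in> T" "\<And>v. c v \<noteq> 0 \<Longrightarrow> v \<in> \<sigma>"
      unfolding P barycentric_def by blast
    then show "x \<in> \<Union>((hull) convex ` T)" using hull' by blast
  qed
  moreover have "unimodularly_equivalent (convex hull \<sigma>) standard_simplex" if "\<sigma> \<in> T" for \<sigma>
    using unimodular_equivalent_convex_hull \<sigma> that by blast
  ultimately show ?thesis
    unfolding unimodular_triangulation_def lattice_triangulation_def by blast
qed

subsection \<open>Lifting a triangulation to the region between two integral functions\<close>

text \<open>Affinity of \<open>l\<close> and \<open>u\<close> is stated as compatibility with affine
  combinations of arbitrary sign, since it is applied to convex as well as to integral ones.
  \<open>nondegenerate\<close> excludes a base simplex without any step to make. The rank is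
  injective on all vertices at once, not on each simplex separately.\<close>

locale chimney =
  fixes A :: "'d::finite set" and b :: 'd and T :: "(real ^ 'd) set set" and P :: "(real ^ 'd) set"
    and l u :: "real ^ 'd \<Rightarrow> real" and \<rho> :: "real ^ 'd \<Rightarrow> nat"
  assumes base: "unimodular_complex A T P"
    and b: "b \<notin> A"
    and l_affine: "\<And>V c. finite V \<Longrightarrow> sum c V = 1 \<Longrightarrow> l (\<Sum>v\<in>V. c v *\<^sub>R v) = (\<Sum>v\<in>V. c v * l v)"
    and u_affine: "\<And>V c. finite V \<Longrightarrow> sum c V = 1 \<Longrightarrow> u (\<Sum>v\<in>V. c v *\<^sub>R v) = (\<Sum>v\<in>V. c v * u v)"
    and l_integral: "\<And>v. v \<in> coord_lattice A \<Longrightarrow> l v \<in> \<int>"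
    and u_integral: "\<And>v. v \<in> coord_lattice A \<Longrightarrow> u v \<in> \<int>"
    and l_le_u: "\<And>x. x \<in> P \<Longrightarrow> l x \<le> u x"
    and nondegenerate: "\<exists>z\<in>coord_lattice A. l z \<noteq> u z"
    and rank_inj: "inj_on \<rho> (\<Union>T)"
begin

abbreviation V where "V \<equiv> \<Union>T"
text \<open>At vertices \<open>l\<close> and \<open>u\<close> are integral, so the floor is only a
  change of type.\<close>

abbreviation L where "L v \<equiv> \<lfloor>l v\<rfloor>"
abbreviation U where "U v \<equiv> \<lfloor>u v\<rfloor>"

definition lift :: "real ^ 'd \<Rightarrow> real \<Rightarrow> real ^ 'd" where
  "lift v t = v + t *\<^sub>R axis b 1"

definition proj :: "real ^ 'd \<Rightarrow> real ^ 'd" where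
  "proj p = p - (p $ b) *\<^sub>R axis b 1"

text \<open>
  The step in which \<open>w\<close> moves from height \<open>k\<close> to \<open>k + 1\<close>: the vertices before \<open>w\<close> are already raised,
  those after \<open>w\<close> are not.
\<close>

definition level :: "real ^ 'd \<Rightarrow> int \<Rightarrow> real ^ 'd \<Rightarrow> int" where
  "level w k v = (if \<rho> v < \<rho> w then U v else if v = w then k else L v)"

definition cell :: "(real ^ 'd) set \<Rightarrow> real ^ 'd \<Rightarrow> int \<Rightarrow> (real ^ 'd) set" where
  "cell \<sigma> w k = insert (lift w (real_of_int k + 1)) ((\<lambda>v. lift v (level w k v)) ` \<sigma>)"

definition cells :: "(real ^ 'd) set set" where
  "cells = {cell \<sigma> w k | \<sigma> w k. \<sigma> \<in> T \<and> w \<in> \<sigma> \<and> L w \<le> k \<and> k < U w}"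

definition region :: "(real ^ 'd) set" where
  "region = {lift x y | x y. x \<in> P \<and> l x \<le> y \<and> y \<le> u x}"

lemma base_facts:
  shows "finite T"
    and "\<And>\<sigma>. \<sigma> \<in> T \<Longrightarrow> finite \<sigma>" "\<And>\<sigma>. \<sigma> \<in> T \<Longrightarrow> card \<sigma> = Suc (card A)"
    and "\<And>\<sigma>. \<sigma> \<in> T \<Longrightarrow> \<sigma> \<subseteq> coord_lattice A"
    and "\<And>\<sigma>. \<sigma> \<in> T \<Longrightarrow> integral_affine_spanning \<sigma> (coord_lattice A)"
    and "\<And>x. x \<in> P \<longleftrightarrow> (\<exists>c. barycentric T x c)"
    and "\<And>x c c'. barycentric T x c \<Longrightarrow> barycentric T x c' \<Longrightarrow> c = c'"
  using base unfolding unimodular_complex_def by blast+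

lemma finite_V: "finite V"
  using base_facts(1,2) by auto

lemma V_lattice: "v \<in> V \<Longrightarrow> v \<in> coord_lattice A"
  using base_facts(4) by auto

lemma lattice_b: "v \<in> coord_lattice A \<Longrightarrow> v $ b = 0"
  using b by (simp add: coord_lattice_def)

lemma L_eq: "v \<in> coord_lattice A \<Longrightarrow> real_of_int (L v) = l v"
  using l_integral[of v] by (auto elim: Ints_cases)

lemma U_eq: "v \<in> coord_lattice A \<Longrightarrow> real_of_int (U v) = u v"
  using u_integral[of v] by (auto elim: Ints_cases)

lemma V_P:
  assumes "v \<in> V"
  shows "v \<in> P"
proof -
  obtain \<sigma> where \<sigma>: "\<sigma> \<in> T" "v \<in> \<sigma>" using assms by auto
  have "barycentric T v (\<lambda>x. if x \<in> \<sigma> then (if x = v then 1 else 0) else 0)"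
    by (rule barycentric_extend[OF finite_V \<sigma>(1)])
       (use \<sigma> base_facts(2) in \<open>auto simp: if_distrib[of "\<lambda>c. c *\<^sub>R _"] cong: if_cong\<close>)
  then show ?thesis using base_facts(6) by blast
qed

lemma L_le_U: "v \<in> V \<Longrightarrow> L v \<le> U v"
  using l_le_u[OF V_P] by (simp add: floor_mono)

lemma P_b:
  assumes "x \<in> P"
  shows "x $ b = 0"
proof -
  obtain c where "(\<Sum>v\<in>V. c v *\<^sub>R v) = x"
    using assms base_facts(6) by (auto simp: barycentric_def)
  then have "x $ b = (\<Sum>v\<in>V. c v * v $ b)" by auto
  then show ?thesis using V_lattice lattice_b by simp
qed

lemma lift_b [simp]: "lift v t $ b = v $ b + t"
  by (simp add: lift_def)

lemma proj_lift [simp]: "v $ b = 0 \<Longrightarrow> proj (lift v t) = v"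
  by (simp add: proj_def lift_def)

lemma lift_proj: "lift (proj p) (p $ b) = p"
  by (simp add: proj_def lift_def)

lemma linear_proj: "linear proj"
  by (rule linearI) (auto simp: proj_def algebra_simps)

lemma lift_eq_iff: "v $ b = 0 \<Longrightarrow> v' $ b = 0 \<Longrightarrow> lift v t = lift v' t' \<longleftrightarrow> v = v' \<and> t = t'"
  by (metis proj_lift lift_b add_0)

lemma V_lift_eq_iff: "v \<in> V \<Longrightarrow> v' \<in> V \<Longrightarrow> lift v t = lift v' t' \<longleftrightarrow> v = v' \<and> t = t'"
  using lift_eq_iff V_lattice lattice_b by blast

section \<open>A single cell: its vertices, weights and integral spanning\<close>

context
  fixes \<sigma> w and k :: int
  assumes \<sigma>: "\<sigma> \<in> T" and w: "w \<in> \<sigma>"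
begin

lemma inj_cell: "inj_on (\<lambda>v. lift v (level w k v)) \<sigma>"
  by (rule inj_onI) (metis UnionI \<sigma> V_lift_eq_iff)

lemma apex_notin: "lift w (real_of_int k + 1) \<notin> (\<lambda>v. lift v (level w k v)) ` \<sigma>"
proof
  assume "lift w (real_of_int k + 1) \<in> (\<lambda>v. lift v (level w k v)) ` \<sigma>"
  then obtain v where "v \<in> \<sigma>" "lift w (real_of_int k + 1) = lift v (level w k v)" by auto
  then have "real_of_int k + 1 = level w k w"
    by (metis UnionI \<sigma> w V_lift_eq_iff)
  then show False by (simp add: level_def)
qed

lemma card_cell: "card (cell \<sigma> w k) = Suc (card \<sigma>)"
  unfolding cell_def using apex_notin base_facts(2)[OF \<sigma>] by (simp add: card_image inj_cell)

lemma sum_cell: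
  "sum F (cell \<sigma> w k) = F (lift w (real_of_int k + 1)) + (\<Sum>v\<in>\<sigma>. F (lift v (level w k v)))"
  unfolding cell_def using apex_notin base_facts(2)[OF \<sigma>] by (simp add: sum.reindex inj_cell)

text \<open>Base weights \<open>c\<close> are carried up to the lower copy of
  \<open>\<sigma>\<close>, and the amount \<open>m\<close> is moved from \<open>w\<close> to its
  raised copy. As that copy is one unit higher, the height grows by exactly \<open>m\<close>. No
  signs are imposed, so the same formula serves integral and convex combinations.\<close>

definition cell_weight :: "(real ^ 'd \<Rightarrow> real) \<Rightarrow> real \<Rightarrow> real ^ 'd \<Rightarrow> real" where
  "cell_weight c m p = (if p = lift w (real_of_int k + 1) then m else c (proj p) - (if proj p = w then m else 0))"

lemma cell_weight_apex: "cell_weight c m (lift w (real_of_int k + 1)) = m"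
  by (simp add: cell_weight_def)

lemma cell_weight_level:
  "v \<in> \<sigma> \<Longrightarrow> cell_weight c m (lift v (level w k v)) = c v - (if v = w then m else 0)"
  using apex_notin \<sigma> V_lattice lattice_b by (force simp: cell_weight_def)

lemma cell_weight_sum: "sum (cell_weight c m) (cell \<sigma> w k) = sum c \<sigma>"
  using base_facts(2)[OF \<sigma>] w
  by (simp add: sum_cell cell_weight_apex cell_weight_level sum_subtractf)

lemma cell_weight_combination:
  "(\<Sum>p\<in>cell \<sigma> w k. cell_weight c m p *\<^sub>R p) =
     lift (\<Sum>v\<in>\<sigma>. c v *\<^sub>R v) ((\<Sum>v\<in>\<sigma>. c v * level w k v) + m)"
proof -
  have "(\<Sum>v\<in>\<sigma>. cell_weight c m (lift v (level w k v)) *\<^sub>R lift v (level w k v)) =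
      (\<Sum>v\<in>\<sigma>. c v *\<^sub>R lift v (level w k v) - (if v = w then m *\<^sub>R lift w (level w k w) else 0))"
    by (rule sum.cong) (auto simp: cell_weight_level algebra_simps)
  also have "\<dots> = (\<Sum>v\<in>\<sigma>. c v *\<^sub>R lift v (level w k v)) - m *\<^sub>R lift w k"
    using base_facts(2)[OF \<sigma>] w by (simp add: sum_subtractf level_def)
  also have "(\<Sum>v\<in>\<sigma>. c v *\<^sub>R lift v (level w k v)) =
      lift (\<Sum>v\<in>\<sigma>. c v *\<^sub>R v) (\<Sum>v\<in>\<sigma>. c v * level w k v)"
    by (simp add: lift_def scaleR_add_right sum.distrib scaleR_sum_left)
  finally have "(\<Sum>p\<in>cell \<sigma> w k. cell_weight c m p *\<^sub>R p) = m *\<^sub>R lift w (real_of_int k + 1) +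
      (lift (\<Sum>v\<in>\<sigma>. c v *\<^sub>R v) (\<Sum>v\<in>\<sigma>. c v * level w k v) - m *\<^sub>R lift w k)"
    by (simp only: sum_cell cell_weight_apex)
  then show ?thesis
    by (simp add: lift_def algebra_simps)
qed

text \<open>Integral base coefficients for \<open>proj z\<close> already give the right projection;
  the height error \<open>m\<close> is an integer and is repaired by moving \<open>m\<close> to the
  apex. Steps of height one are what keep the coefficients integral.\<close>

lemma cell_spanning: "integral_affine_spanning (cell \<sigma> w k) (coord_lattice (insert b A))"
  unfolding integral_affine_spanning_def
proof
  fix z assume z: "z \<in> coord_lattice (insert b A)"
  then have "proj z \<in> coord_lattice A"
    using b by (auto simp: coord_lattice_def integer_lattice_def proj_def axis_def)
  then obtain c where c: "\<And>v. c v \<in> \<int>" "sum c \<sigma> = 1" "(\<Sum>v\<in>\<sigma>. c v *\<^sub>R v) = proj z"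
    using base_facts(5)[OF \<sigma>] by (auto simp: integral_affine_spanning_def)
  define m where "m = z $ b - (\<Sum>v\<in>\<sigma>. c v * level w k v)"
  have "m \<in> \<int>"
    unfolding m_def using z c by (intro Ints_diff Ints_sum) (auto simp: coord_lattice_def integer_lattice_def)
  then have "\<forall>p. cell_weight c m p \<in> \<int>" using c(1) by (auto simp: cell_weight_def)
  moreover have "(\<Sum>p\<in>cell \<sigma> w k. cell_weight c m p *\<^sub>R p) = z"
    by (simp add: cell_weight_combination c m_def lift_proj)
  ultimately show "\<exists>c. (\<forall>v. c v \<in> \<int>) \<and> sum c (cell \<sigma> w k) = 1 \<and> (\<Sum>v\<in>cell \<sigma> w k. c v *\<^sub>R v) = z"
    using cell_weight_sum c(2) by metis
qed

lemma level_bounds: "v \<in> \<sigma> \<Longrightarrow> L w \<le> k \<Longrightarrow> k \<le> U w \<Longrightarrow> L v \<le> level w k v \<and> level w k v \<le> U v"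
  using L_le_U[of v] \<sigma> by (auto simp: level_def)

lemma cell_cases:
  assumes "p \<in> cell \<sigma> w k" and "L w \<le> k" "k < U w"
  obtains v j where "v \<in> \<sigma>" "p = lift v (real_of_int j)" "L v \<le> j" "j \<le> U v"
    "j = level w k v \<or> v = w \<and> j = k + 1"
proof (cases "p = lift w (real_of_int k + 1)")
  case True
  then show ?thesis using that[of w "k + 1"] w assms by auto
next
  case False
  then show ?thesis using that level_bounds assms by (auto simp: cell_def)
qed

lemma cell_lattice:
  assumes "L w \<le> k" "k < U w"
  shows "cell \<sigma> w k \<subseteq> coord_lattice (insert b A)"
proof
  fix p assume "p \<in> cell \<sigma> w k"
  then obtain v j where "v \<in> \<sigma>" "p = lift v (real_of_int j)"
    by (rule cell_cases[OF _ assms])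
  then show "p \<in> coord_lattice (insert b A)"
    using base_facts(4)[OF \<sigma>] by (auto simp: coord_lattice_def integer_lattice_def lift_def axis_def subset_iff)
qed

end

section \<open>The vertices of all cells, sorted into fibres over the base vertices\<close>

lemma finite_cells: "finite cells"
proof -
  have "cells \<subseteq> (\<lambda>(\<sigma>, w, k). cell \<sigma> w k) ` (SIGMA \<sigma>:T. SIGMA w:\<sigma>. {L w..<U w})"
    unfolding cells_def by force
  then show ?thesis
    by (rule finite_subset) (use base_facts(1,2) in auto)
qed

lemma cell_vertexE:
  assumes "p \<in> \<Union>cells"
  obtains v j where "v \<in> V" "j \<in> {L v..U v}" "p = lift v (real_of_int j)"
proof -
  obtain \<sigma> w k where s: "\<sigma> \<in> T" "w \<in> \<sigma>" "L w \<le> k" "k < U w" and p: "p \<in> cell \<sigma> w k"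
    using assms unfolding cells_def by auto
  obtain v j where "v \<in> \<sigma>" "p = lift v (real_of_int j)" "L v \<le> j" "j \<le> U v"
    by (rule cell_cases[OF s(1,2) p s(3,4)])
  then show ?thesis using s(1) by (intro that[of v j]) auto
qed

lemma cell_vertices: "\<Union>cells \<subseteq> (\<lambda>(v, j). lift v (real_of_int j)) ` (SIGMA v:V. {L v..U v})"
  by (rule subsetI, erule cell_vertexE) force

lemma finite_cell_vertices: "finite (\<Union>cells)"
  by (rule finite_subset[OF cell_vertices]) (use finite_V in auto)

text \<open>The cell vertices are only known to lie among the integer points of the fibres, so
  \<open>G\<close> has to vanish off the vertices before the sum can be extended to full
  fibres.\<close>

lemma sum_fibres:
  assumes "\<And>p. p \<notin> \<Union>cells \<Longrightarrow> G p = 0"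
  shows "sum G (\<Union>cells) = (\<Sum>v\<in>V. \<Sum>j=L v..U v. G (lift v (real_of_int j)))"
proof -
  let ?S = "SIGMA v:V. {L v..U v}" and ?f = "\<lambda>(v, j). lift v (real_of_int j)"
  have "inj_on ?f ?S" by (auto intro!: inj_onI dest: V_lift_eq_iff[THEN iffD1, rotated 2])
  then have "sum G (?f ` ?S) = (\<Sum>x\<in>?S. G (?f x))" by (simp add: sum.reindex)
  also have "\<dots> = (\<Sum>v\<in>V. \<Sum>j=L v..U v. G (lift v (real_of_int j)))"
    by (subst sum.Sigma) (use finite_V in \<open>auto simp: case_prod_beta\<close>)
  finally show ?thesis
    using sum.mono_neutral_left[OF _ cell_vertices, of G] assms finite_V by auto
qed

text \<open>The height \<open>y - l x\<close> is a budget. Raising \<open>v\<close> completely costs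
  \<open>a v = c v * (U v - L v)\<close>, and raising everything costs \<open>u x - l x\<close>.
  Spending in rank order, the budget runs out at some \<open>w\<close>; within \<open>w\<close> each
  unit step costs \<open>c w\<close>, which selects \<open>k\<close>; the rest becomes the weight of
  the apex.\<close>

lemma region_covered:
  assumes x: "x \<in> P" and y: "l x \<le> y" "y \<le> u x"
  shows "\<exists>c. barycentric cells (lift x y) c"
proof -
  obtain c where c: "barycentric T x c" using x base_facts(6) by blast
  then obtain \<sigma> where \<sigma>: "\<sigma> \<in> T" and supp: "\<And>v. c v \<noteq> 0 \<Longrightarrow> v \<in> \<sigma>" and c0: "\<And>v. 0 \<le> c v"
    by (auto simp: barycentric_def)
  have c1: "sum c \<sigma> = 1" and cx: "(\<Sum>v\<in>\<sigma>. c v *\<^sub>R v) = x"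
    using barycentric_restrict[OF finite_V \<sigma> c supp] by auto
  have fin: "finite \<sigma>" using base_facts(2)[OF \<sigma>] .
  have lat: "v \<in> coord_lattice A" if "v \<in> \<sigma>" for v using base_facts(4)[OF \<sigma>] that by auto
  have LU: "L v \<le> U v" if "v \<in> \<sigma>" for v using L_le_U \<sigma> that by auto
  have lx: "l x = (\<Sum>v\<in>\<sigma>. c v * L v)" and ux: "u x = (\<Sum>v\<in>\<sigma>. c v * U v)"
    using l_affine[OF fin c1] u_affine[OF fin c1] by (simp_all add: cx L_eq U_eq lat)
  \<comment> \<open>Restricting to vertices with room to move guarantees \<open>L w < U w\<close>,
    so that the selected \<open>w\<close> has a step. The discarded vertices have
    \<open>a v = 0\<close> and do not affect the partial sums.\<close>
  define W where "W = {v \<in> \<sigma>. L v < U v}"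
  define a where "a v = c v * (U v - L v)" for v
  have a0: "0 \<le> a v" if "v \<in> \<sigma>" for v using c0 LU that by (simp add: a_def)
  have "W \<noteq> {}"
  proof
    assume "W = {}"
    then have LU: "l v = u v" if "v \<in> \<sigma>" for v
      using LU[OF that] L_eq[OF lat[OF that]] U_eq[OF lat[OF that]] that by (force simp: W_def)
    obtain z where z: "z \<in> coord_lattice A" "l z \<noteq> u z" using nondegenerate by blast
    then obtain e where e: "sum e \<sigma> = 1" "(\<Sum>v\<in>\<sigma>. e v *\<^sub>R v) = z"
      using base_facts(5)[OF \<sigma>] by (auto simp: integral_affine_spanning_def)
    show False using l_affine[OF fin e(1)] u_affine[OF fin e(1)] e(2) z(2) LU by simp
  qed
  have sumW: "sum a {v \<in> W. Q v} = sum a {v \<in> \<sigma>. Q v}" for Q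
    by (rule sum.mono_neutral_left) (use fin LU in \<open>auto simp: W_def a_def\<close>, force)
  have "sum a W = u x - l x"
    using sumW[of "\<lambda>_. True"] by (simp add: lx ux a_def right_diff_distrib sum_subtractf)
  then obtain w where w: "w \<in> W" "sum a {v\<in>W. \<rho> v < \<rho> w} \<le> y - l x"
      "y - l x \<le> sum a {v\<in>W. \<rho> v < \<rho> w} + a w"
    using partial_sum_bracket[of W \<rho> a "y - l x"] \<open>W \<noteq> {}\<close> fin a0 y \<sigma> inj_on_subset[OF rank_inj, of W]
    by (auto simp: W_def)
  define F where "F = sum a {v\<in>\<sigma>. \<rho> v < \<rho> w}"
  have wF: "F \<le> y - l x" "y - l x \<le> F + a w" using w sumW by (auto simp: F_def)
  have w\<sigma>: "w \<in> \<sigma>" "L w < U w" using w by (auto simp: W_def)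
  \<comment> \<open>The same bracketing, now with equal weights \<open>c w\<close> on the unit steps
    of \<open>w\<close>, ordered by height.\<close>
  have "\<exists>k\<in>{L w..<U w}. (\<Sum>i\<in>{i \<in> {L w..<U w}. id i < id k}. c w) \<le> y - l x - F \<and>
      y - l x - F \<le> (\<Sum>i\<in>{i \<in> {L w..<U w}. id i < id k}. c w) + c w"
    by (rule partial_sum_bracket) (use w\<sigma> wF c0 in \<open>auto simp: a_def mult.commute\<close>)
  then obtain k where k: "L w \<le> k" "k < U w"
      "(\<Sum>i\<in>{i \<in> {L w..<U w}. i < k}. c w) \<le> y - l x - F"
      "y - l x - F \<le> (\<Sum>i\<in>{i \<in> {L w..<U w}. i < k}. c w) + c w" by auto
  have "{i \<in> {L w..<U w}. i < k} = {L w..<k}" using k by auto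
  then have kF: "c w * (k - L w) \<le> y - l x - F" "y - l x - F \<le> c w * (k - L w) + c w"
    using k by (simp_all add: mult.commute)
  have "(\<Sum>v\<in>\<sigma>. c v * level w k v) = (\<Sum>v\<in>\<sigma>. c v * L v + (if \<rho> v < \<rho> w then a v else 0)
      + (if v = w then c w * (k - L w) else 0))"
    by (rule sum.cong) (auto simp: level_def a_def algebra_simps)
  also have "\<dots> = l x + F + c w * (k - L w)"
    using fin w\<sigma> by (simp add: sum.distrib lx F_def sum.If_cases Int_def conj_commute)
  finally have lev: "(\<Sum>v\<in>\<sigma>. c v * level w k v) = l x + F + c w * (k - L w)" .
  \<comment> \<open>The unspent remainder, at most the price \<open>c w\<close> of one step, so that
    both \<open>m\<close> and the weight \<open>c w - m\<close> left on the lower copy of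
    \<open>w\<close> are nonnegative.\<close>
  define m where "m = y - (\<Sum>v\<in>\<sigma>. c v * level w k v)"
  have m: "0 \<le> m" "m \<le> c w" using kF lev by (auto simp: m_def)
  let ?d = "cell_weight w k c m"
  note cw = cell_weight_sum[OF \<sigma> w\<sigma>(1), of k c m] cell_weight_combination[OF \<sigma> w\<sigma>(1), of k c m]
  have "barycentric cells (lift x y) (\<lambda>p. if p \<in> cell \<sigma> w k then ?d p else 0)"
  proof (rule barycentric_extend[OF finite_cell_vertices])
    show "cell \<sigma> w k \<in> cells" using \<sigma> w\<sigma> k by (auto simp: cells_def)
    show "0 \<le> ?d p" for p using m c0 by (auto simp: cell_weight_def[OF \<sigma> w\<sigma>(1)])
    show "sum ?d (cell \<sigma> w k) = 1" using cw c1 by simp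
    show "(\<Sum>p\<in>cell \<sigma> w k. ?d p *\<^sub>R p) = lift x y" using cw cx by (simp add: m_def)
  qed
  then show ?thesis by blast
qed

section \<open>Masses and moments of the fibres: cells stay inside the region and coordinates are
  unique\<close>

definition fibre_mass :: "(real ^ 'd \<Rightarrow> real) \<Rightarrow> real ^ 'd \<Rightarrow> real" where
  "fibre_mass d v = (if v \<in> V then \<Sum>j=L v..U v. d (lift v (real_of_int j)) else 0)"

definition fibre_moment :: "(real ^ 'd \<Rightarrow> real) \<Rightarrow> real ^ 'd \<Rightarrow> real" where
  "fibre_moment d v = (\<Sum>j=L v..U v. d (lift v (real_of_int j)) * real_of_int j)"

lemma barycentric_outside: "barycentric T' p d \<Longrightarrow> q \<notin> \<Union>T' \<Longrightarrow> d q = 0"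
  unfolding barycentric_def by blast

text \<open>A cell over \<open>\<sigma>\<close> projects onto \<open>\<sigma>\<close> and
  \<open>proj\<close> is linear, so pushing the weights down gives base coordinates of
  \<open>proj p\<close>. Setting the mass to 0 off \<open>V\<close> makes uniqueness in the base
  applicable as an equality of functions.\<close>

lemma barycentric_fibre_mass:
  assumes d: "barycentric cells p d"
  shows "barycentric T (proj p) (fibre_mass d)"
proof -
  have out: "\<And>q. q \<notin> \<Union>cells \<Longrightarrow> d q = 0" using barycentric_outside[OF d] .
  have d0: "\<And>q. 0 \<le> d q" and d1: "sum d (\<Union>cells) = 1" and dp: "(\<Sum>q\<in>\<Union>cells. d q *\<^sub>R q) = p"
    using d by (auto simp: barycentric_def)
  obtain \<sigma> w k where s: "\<sigma> \<in> T" "w \<in> \<sigma>" "L w \<le> k" "k < U w" and supp: "\<And>q. d q \<noteq> 0 \<Longrightarrow> q \<in> cell \<sigma> w k"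
    using d unfolding barycentric_def cells_def by blast
  have "v \<in> \<sigma>" if "fibre_mass d v \<noteq> 0" for v
  proof -
    have v: "v \<in> V" using that by (auto simp: fibre_mass_def split: if_splits)
    with that have "(\<Sum>j=L v..U v. d (lift v (real_of_int j))) \<noteq> 0" by (simp add: fibre_mass_def)
    then obtain j where "d (lift v (real_of_int j)) \<noteq> 0"
      by (rule sum.not_neutral_contains_not_neutral)
    then have "lift v (real_of_int j) \<in> cell \<sigma> w k" by (rule supp)
    then obtain v' j' where "v' \<in> \<sigma>" "lift v (real_of_int j) = lift v' (real_of_int j')"
      by (rule cell_cases[OF s(1,2) _ s(3,4)])
    then show ?thesis using V_lift_eq_iff[OF v, of v'] s(1) by auto
  qed
  moreover have "0 \<le> fibre_mass d v" for v using d0 by (auto simp: fibre_mass_def intro: sum_nonneg)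
  moreover have "sum (fibre_mass d) V = 1"
    using sum_fibres[of d] out d1 by (simp add: fibre_mass_def)
  moreover have "(\<Sum>v\<in>V. fibre_mass d v *\<^sub>R v) = proj p"
  proof -
    have "proj p = (\<Sum>q\<in>\<Union>cells. d q *\<^sub>R proj q)"
      by (simp add: linear_sum[OF linear_proj] linear_cmul[OF linear_proj] flip: dp)
    also have "\<dots> = (\<Sum>v\<in>V. \<Sum>j=L v..U v. d (lift v (real_of_int j)) *\<^sub>R proj (lift v (real_of_int j)))"
      by (rule sum_fibres) (simp add: out)
    also have "\<dots> = (\<Sum>v\<in>V. fibre_mass d v *\<^sub>R v)"
      by (rule sum.cong) (use V_lattice lattice_b in \<open>auto simp: fibre_mass_def scaleR_sum_left\<close>)
    finally show ?thesis by simp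
  qed
  ultimately show ?thesis using s(1) unfolding barycentric_def by blast
qed

lemma sum_fibre_moment:
  assumes d: "barycentric cells p d"
  shows "sum (fibre_moment d) V = p $ b"
proof -
  have out: "\<And>q. q \<notin> \<Union>cells \<Longrightarrow> d q = 0" using barycentric_outside[OF d] .
  have "p $ b = (\<Sum>q\<in>\<Union>cells. d q * q $ b)"
    using d by (auto simp: barycentric_def)
  also have "\<dots> = (\<Sum>v\<in>V. \<Sum>j=L v..U v. d (lift v (real_of_int j)) * lift v (real_of_int j) $ b)"
    by (rule sum_fibres) (simp add: out)
  also have "\<dots> = sum (fibre_moment d) V"
    by (rule sum.cong) (use V_lattice lattice_b in \<open>auto simp: fibre_moment_def\<close>)
  finally show ?thesis by simp
qed

lemma fibre_moment_bounds:
  assumes d: "barycentric cells p d" and v: "v \<in> V"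
  shows "fibre_mass d v * L v \<le> fibre_moment d v" "fibre_moment d v \<le> fibre_mass d v * U v"
  using d v
  by (auto simp: fibre_moment_def fibre_mass_def sum_distrib_right barycentric_def
      intro!: sum_mono mult_left_mono)

text \<open>The last coordinate is the sum of the moments, each lying between the mass times
  \<open>L v\<close> and the mass times \<open>U v\<close>. Affinity turns the two bounding sums
  into \<open>l (proj p)\<close> and \<open>u (proj p)\<close>.\<close>

lemma barycentric_in_region:
  assumes d: "barycentric cells p d"
  shows "p \<in> region"
proof -
  let ?c = "fibre_mass d"
  have c: "barycentric T (proj p) ?c" using barycentric_fibre_mass[OF d] .
  then have "proj p \<in> P" using base_facts(6) by blast
  have c1: "sum ?c V = 1" and cp: "(\<Sum>v\<in>V. ?c v *\<^sub>R v) = proj p"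
    using c by (auto simp: barycentric_def)
  have "l (proj p) = (\<Sum>v\<in>V. ?c v * L v)"
    using l_affine[OF finite_V c1] by (simp add: cp L_eq V_lattice del: Union_iff)
  also have "\<dots> \<le> p $ b"
    unfolding sum_fibre_moment[OF d, symmetric] using fibre_moment_bounds[OF d] by (intro sum_mono) auto
  finally have "l (proj p) \<le> p $ b" .
  have "p $ b \<le> (\<Sum>v\<in>V. ?c v * U v)"
    unfolding sum_fibre_moment[OF d, symmetric] using fibre_moment_bounds[OF d] by (intro sum_mono) auto
  also have "\<dots> = u (proj p)"
    using u_affine[OF finite_V c1] by (simp add: cp U_eq V_lattice del: Union_iff)
  finally have "p $ b \<le> u (proj p)" .
  with \<open>proj p \<in> P\<close> \<open>l (proj p) \<le> p $ b\<close> show ?thesis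
    unfolding region_def using lift_proj[of p] by force
qed

lemma fibre_support:
  assumes s: "\<sigma> \<in> T" "w \<in> \<sigma>" "L w \<le> k" "k < U w" and supp: "\<And>q. d q \<noteq> 0 \<Longrightarrow> q \<in> cell \<sigma> w k"
    and v: "v \<in> V" and j: "d (lift v (real_of_int j)) \<noteq> 0"
  shows "j = level w k v \<or> v = w \<and> j = k + 1"
proof -
  have "lift v (real_of_int j) \<in> cell \<sigma> w k" by (rule supp[OF j])
  then obtain v' j' where "v' \<in> \<sigma>" "lift v (real_of_int j) = lift v' (real_of_int j')"
    "j' = level w k v' \<or> v' = w \<and> j' = k + 1"
    by (rule cell_cases[OF s(1,2) _ s(3,4)])
  moreover from this have "v = v' \<and> real_of_int j = real_of_int j'"
    using V_lift_eq_iff[OF v, of v'] s(1) by blast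
  ultimately show ?thesis by auto
qed

text \<open>Away from \<open>w\<close> a cell has at most one vertex in each fibre, so the moment is
  the mass times the height \<open>level w k v\<close>. This supplies the threshold shape required
  by \<open>threshold_unique\<close>.\<close>

lemma fibre_moment_extreme:
  assumes s: "\<sigma> \<in> T" "w \<in> \<sigma>" "L w \<le> k" "k < U w" and supp: "\<And>q. d q \<noteq> 0 \<Longrightarrow> q \<in> cell \<sigma> w k"
    and v: "v \<in> V"
  shows "\<rho> v < \<rho> w \<Longrightarrow> fibre_moment d v = fibre_mass d v * U v"
    and "\<rho> w < \<rho> v \<Longrightarrow> fibre_moment d v = fibre_mass d v * L v"
proof -
  have eq: "fibre_moment d v = fibre_mass d v * level w k v" if "v \<noteq> w"
  proof -
    have "d (lift v (real_of_int j)) * real_of_int j = d (lift v (real_of_int j)) * real_of_int (level w k v)" for j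
      using fibre_support[where d = d, OF s supp v, of j] that by (cases "d (lift v (real_of_int j)) = 0") auto
    then show ?thesis using v by (simp only: fibre_moment_def fibre_mass_def sum_distrib_right if_True)
  qed
  show "fibre_moment d v = fibre_mass d v * U v" if "\<rho> v < \<rho> w"
    using that eq by (auto simp: level_def)
  show "fibre_moment d v = fibre_mass d v * L v" if "\<rho> w < \<rho> v"
    using that eq by (auto simp: level_def)
qed

text \<open>
  The weights are recovered fibrewise: the base weights determine the masses, the last coordinate
  determines the moments (\<open>threshold_unique\<close>), and mass and moment determine a distribution on two
  consecutive heights.
\<close>

lemma barycentric_cells_unique:
  assumes d: "barycentric cells p d" and d': "barycentric cells p d'"
  shows "d = d'"
proof -
  obtain \<sigma> w k where s: "\<sigma> \<in> T" "w \<in> \<sigma>" "L w \<le> k" "k < U w"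
    and supp: "\<And>q. d q \<noteq> 0 \<Longrightarrow> q \<in> cell \<sigma> w k"
    using d unfolding barycentric_def cells_def by blast
  obtain \<sigma>' w' k' where s': "\<sigma>' \<in> T" "w' \<in> \<sigma>'" "L w' \<le> k'" "k' < U w'"
    and supp': "\<And>q. d' q \<noteq> 0 \<Longrightarrow> q \<in> cell \<sigma>' w' k'"
    using d' unfolding barycentric_def cells_def by blast
  have mass: "fibre_mass d = fibre_mass d'"
    using barycentric_fibre_mass[OF d] barycentric_fibre_mass[OF d'] base_facts(7) by blast
  have moment: "fibre_moment d v = fibre_moment d' v" if v: "v \<in> V" for v
  proof -
    \<comment> \<open>The excess over the lower graph, with cap mass times \<open>U v - L v\<close>.
      Both weight systems share this cap because their masses agree, although their cells may
      differ.\<close>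
    let ?H = "\<lambda>d v. fibre_moment d v - fibre_mass d v * L v"
    have "?H d v = ?H d' v"
    proof (rule threshold_unique[OF finite_V rank_inj, of w w' _ "\<lambda>v. fibre_mass d v * (U v - L v)"])
      show "w \<in> V" "w' \<in> V" using s s' by auto
      show "sum (?H d) V = sum (?H d') V"
        using sum_fibre_moment[OF d] sum_fibre_moment[OF d'] by (simp add: sum_subtractf mass)
    qed (use fibre_moment_bounds[OF d] fibre_moment_bounds[OF d'] v mass
          fibre_moment_extreme[where d = d, OF s supp] fibre_moment_extreme[where d = d', OF s' supp'] in
          \<open>auto simp: right_diff_distrib\<close>)
    then show ?thesis by (simp add: mass)
  qed
  have fibre: "d (lift v (real_of_int j)) = d' (lift v (real_of_int j))"
    if v: "v \<in> V" and j: "j \<in> {L v..U v}" for v j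
  \<comment> \<open>The second height, \<open>level + 1\<close>, is occupied at most over the moving
    vertex; allowing it everywhere treats all fibres alike.\<close>
  proof (rule consecutive_unique[of "{L v..U v}" _ _ "level w k v" "level w' k' v"])
    show "(\<Sum>j=L v..U v. d (lift v (real_of_int j))) = (\<Sum>j=L v..U v. d' (lift v (real_of_int j)))"
      using fun_cong[OF mass, of v] v by (simp add: fibre_mass_def)
    show "(\<Sum>j=L v..U v. d (lift v (real_of_int j)) * real_of_int j) =
        (\<Sum>j=L v..U v. d' (lift v (real_of_int j)) * real_of_int j)"
      using moment[OF v] by (simp add: fibre_moment_def)
    show "i = level w k v \<or> i = level w k v + 1" if "d (lift v (real_of_int i)) \<noteq> 0" for i
      using fibre_support[where d = d, OF s supp v that] by (auto simp: level_def)
    show "i = level w' k' v \<or> i = level w' k' v + 1" if "d' (lift v (real_of_int i)) \<noteq> 0" for i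
      using fibre_support[where d = d', OF s' supp' v that] by (auto simp: level_def)
  qed (use d d' j in \<open>auto simp: barycentric_def\<close>)
  show ?thesis
  proof
    fix q
    show "d q = d' q"
    proof (cases "q \<in> \<Union>cells")
      case True
      then obtain v j where "v \<in> V" "j \<in> {L v..U v}" "q = lift v (real_of_int j)"
        by (rule cell_vertexE)
      then show ?thesis using fibre by simp
    next
      case False
      then show ?thesis using barycentric_outside[OF d] barycentric_outside[OF d'] by simp
    qed
  qed
qed

theorem unimodular_complex_region: "unimodular_complex (insert b A) cells region"
  unfolding unimodular_complex_def
proof (intro conjI ballI allI impI iffI)
  show "finite cells" by (rule finite_cells)
next
  fix \<tau> assume "\<tau> \<in> cells"
  then obtain \<sigma> w k where s: "\<sigma> \<in> T" "w \<in> \<sigma>" "L w \<le> k" "k < U w" and \<tau>: "\<tau> = cell \<sigma> w k"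
    by (auto simp: cells_def)
  show "card \<tau> = Suc (card (insert b A))"
    unfolding \<tau> using card_cell[OF s(1,2)] base_facts(3)[OF s(1)] b by simp
  then show "finite \<tau>" by (intro card_ge_0_finite) simp
  show "\<tau> \<subseteq> coord_lattice (insert b A)" unfolding \<tau> by (rule cell_lattice[OF s])
  show "integral_affine_spanning \<tau> (coord_lattice (insert b A))"
    unfolding \<tau> by (rule cell_spanning[OF s(1,2)])
next
  fix x assume "x \<in> region"
  then show "\<exists>c. barycentric cells x c" using region_covered by (auto simp: region_def)
next
  fix x assume "\<exists>c. barycentric cells x c"
  then show "x \<in> region" using barycentric_in_region by blast
next
  fix x c c' assume "barycentric cells x c" "barycentric cells x c'"
  then show "c = c'" by (rule barycentric_cells_unique)
qed

end

subsection \<open>Lecture hall polytopes\<close>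

text \<open>Starting from a point in dimension zero lets the first coordinate be produced by the
  same lifting as all the others.\<close>

lemma unimodular_complex_empty: "unimodular_complex {} {{0}} {0 :: real ^ 'd::finite}"
proof -
  have "integral_affine_spanning {0} (coord_lattice {} :: (real ^ 'd) set)"
    unfolding integral_affine_spanning_def
    by (intro ballI exI[of _ "\<lambda>_. 1"]) (auto simp: coord_lattice_def vec_eq_iff)
  moreover have "barycentric {{0}} x c \<longleftrightarrow> x = 0 \<and> c = (\<lambda>v. if v = 0 then 1 else 0)"
    for x :: "real ^ 'd" and c
    by (rule iffI; auto simp: barycentric_def; force)
  ultimately show ?thesis
    by (simp add: unimodular_complex_def) (auto simp: coord_lattice_def integer_lattice_def)
qed

text \<open>The polytope of the subsequence indexed by \<open>A\<close>, embedded with zeros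
  elsewhere; the chain inequalities are imposed only inside \<open>A\<close>, not against the zero
  coordinates.\<close>

definition lecture_hall_face ::
    "('d::{finite,linorder} \<Rightarrow> nat) \<Rightarrow> 'd set \<Rightarrow> (real ^ 'd::{finite,linorder}) set" where
  "lecture_hall_face s A =
     {x. (\<forall>i. i \<notin> A \<longrightarrow> x $ i = 0) \<and> (\<forall>i\<in>A. 0 \<le> x $ i / s i \<and> x $ i / s i \<le> 1) \<and>
         (\<forall>i\<in>A. \<forall>j\<in>A. i \<le> j \<longrightarrow> x $ i / s i \<le> x $ j / s j)}"

text \<open>The induction over index sets treats arbitrary \<open>A\<close>, where
  \<open>Max A\<close> need not be the predecessor of the new index, so divisibility is needed for
  all pairs. It follows by splitting at an index in between.\<close>

lemma dvd_if_dvd_successor: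
  fixes s :: "'d::{finite,linorder} \<Rightarrow> nat"
  assumes "\<And>i j. i < j \<Longrightarrow> {i<..<j} = {} \<Longrightarrow> s i dvd s j" and "i < j"
  shows "s i dvd s j"
  using \<open>i < j\<close>
proof (induction "card {i<..<j}" arbitrary: i j rule: less_induct)
  case less
  show ?case
  proof (cases "{i<..<j} = {}")
    case True
    then show ?thesis using assms(1) less.prems by blast
  next
    case False
    then obtain t where t: "i < t" "t < j" by auto
    then have "card {i<..<t} < card {i<..<j}" "card {t<..<j} < card {i<..<j}"
      by (auto intro!: psubset_card_mono)
    then have "s i dvd s t" "s t dvd s j" using less.hyps t by auto
    then show ?thesis by (rule dvd_trans)
  qed
qed

text \<open>With \<open>b\<close> above all of \<open>A\<close> and \<open>m = Max A\<close>, the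
  constraints on the new coordinate reduce to \<open>x $ m / s m \<le> x $ b / s b \<le> 1\<close>,
  that is, to \<open>x $ b\<close> lying between \<open>(s b / s m) * x $ m\<close> and
  \<open>s b\<close>.\<close>

lemma lecture_hall_face_complex:
  fixes s :: "'d::{finite,linorder} \<Rightarrow> nat"
  assumes pos: "\<And>i. s i > 0" and dvd: "\<And>i j. i < j \<Longrightarrow> s i dvd s j"
  shows "\<exists>T. unimodular_complex A T (lecture_hall_face s A)"
  using finite[of A]
proof (induction A rule: finite_linorder_max_induct)
  case empty
  have "lecture_hall_face s {} = {0}" by (auto simp: lecture_hall_face_def vec_eq_iff)
  then show ?case using unimodular_complex_empty by metis
next
  case (insert b A)
  then obtain T where T: "unimodular_complex A T (lecture_hall_face s A)" by blast
  define m where "m = Max A"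
  \<comment> \<open>For empty \<open>A\<close> there is no maximum; slope 0 then makes the lower
    bound \<open>0 \<le> x $ b\<close>, as required of the first coordinate.\<close>
  define q where "q = (if A = {} then 0 else s b div s m)"
  define l where "l x = q * x $ m" for x :: "real ^ 'd::{finite,linorder}"
  define u where "u x = real (s b)" for x :: "real ^ 'd::{finite,linorder}"
  have m: "m \<in> A" "\<And>i. i \<in> A \<Longrightarrow> i \<le> m" if "A \<noteq> {}" using that by (auto simp: m_def)
  have pos': "0 < real (s i)" for i using pos by simp
  have q: "real q = s b / s m" if "A \<noteq> {}"
    using that m(1)[OF that] insert.hyps dvd by (auto simp: q_def real_of_nat_div)
  have l: "l x = s b * (x $ m / s m)" if "A \<noteq> {}" for x using q[OF that] by (simp add: l_def)
  have l0: "l x = 0" if "A = {}" for x using that by (simp add: l_def q_def)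
  \<comment> \<open>Any injective numbering of the vertices serves as the common order.\<close>
  have "finite (\<Union>T)" using T by (auto simp: unimodular_complex_def)
  from finite_imp_inj_to_nat_seg[OF this]
  obtain \<rho> :: "real ^ 'd::{finite,linorder} \<Rightarrow> nat" where \<rho>: "inj_on \<rho> (\<Union>T)" by auto
  have le: "l x \<le> u x" if "x \<in> lecture_hall_face s A" for x
  proof (cases "A = {}")
    case True
    then show ?thesis by (simp add: l0 u_def)
  next
    case False
    then have "x $ m / s m \<le> 1" using that m by (auto simp: lecture_hall_face_def)
    then show ?thesis using pos'[of b] by (simp add: l[OF False] u_def mult_left_le del: times_divide_eq_right)
  qed
  interpret chimney A b T "lecture_hall_face s A" l u \<rho>
  proof
    show "unimodular_complex A T (lecture_hall_face s A)" by (rule T)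
    show "b \<notin> A" using insert.hyps by auto
    show "l (\<Sum>v\<in>V. c v *\<^sub>R v) = (\<Sum>v\<in>V. c v * l v)" for V c
      by (simp add: l_def sum_distrib_left mult.left_commute)
    show "u (\<Sum>v\<in>V. c v *\<^sub>R v) = (\<Sum>v\<in>V. c v * u v)" if "sum c V = 1" for V c
      using that by (simp add: u_def flip: sum_distrib_right)
    show "l v \<in> \<int>" "u v \<in> \<int>" if "v \<in> coord_lattice A" for v
      using that by (auto simp: coord_lattice_def integer_lattice_def l_def u_def)
    \<comment> \<open>At the origin \<open>l\<close> is 0 and \<open>u\<close> is
      \<open>s b > 0\<close>.\<close>
    show "\<exists>z\<in>coord_lattice A. l z \<noteq> u z"
      using pos by (intro bexI[of _ 0]) (auto simp: l_def u_def coord_lattice_def integer_lattice_def)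
  qed (use le \<rho> in auto)
  have "region = lecture_hall_face s (insert b A)"
  proof (intro set_eqI iffI)
    fix p assume "p \<in> region"
    then obtain x y where x: "x \<in> lecture_hall_face s A" and y: "l x \<le> y" "y \<le> u x" and p: "p = lift x y"
      by (auto simp: region_def)
    have pb: "p $ b = y" using P_b[OF x] by (simp add: p)
    have pi: "p $ i = x $ i" if "i \<noteq> b" for i using that by (simp add: p lift_def axis_def)
    have "0 \<le> l x"
    proof (cases "A = {}")
      case True
      then show ?thesis by (simp add: l0)
    next
      case False
      then have "0 \<le> x $ m / s m" using x m(1) by (auto simp: lecture_hall_face_def)
      then show ?thesis unfolding l[OF False] by (intro mult_nonneg_nonneg) auto
    qed
    then have yb: "0 \<le> y / s b" "y / s b \<le> 1" using y pos'[of b] by (auto simp: u_def)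
    have xi: "x $ i / s i \<le> y / s b" if "i \<in> A" for i
    proof -
      have A: "A \<noteq> {}" using that by auto
      have "x $ i / s i \<le> x $ m / s m" using x m[OF A] that by (auto simp: lecture_hall_face_def)
      also have "\<dots> = l x / s b" using pos'[of b] by (simp add: l[OF A])
      also have "\<dots> \<le> y / s b" using y by (simp add: divide_right_mono)
      finally show ?thesis .
    qed
    have "\<not> b \<le> i" if "i \<in> A" for i using insert.hyps that by auto
    moreover have "i \<noteq> b" if "i \<in> A" for i using insert.hyps that by auto
    ultimately show "p \<in> lecture_hall_face s (insert b A)"
      using x yb xi pb pi by (auto simp: lecture_hall_face_def)
  next
    fix p assume p: "p \<in> lecture_hall_face s (insert b A)"
    have pi: "proj p $ i = p $ i" if "i \<noteq> b" for i using that by (simp add: proj_def axis_def)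
    have pb: "proj p $ b = 0" by (simp add: proj_def)
    have ne: "i \<noteq> b" if "i \<in> A" for i using insert.hyps that by auto
    have "proj p \<in> lecture_hall_face s A"
      using p pi pb ne unfolding lecture_hall_face_def by (simp, metis)
    moreover have "l (proj p) \<le> p $ b"
    proof (cases "A = {}")
      case True
      then show ?thesis using p pos'[of b] by (auto simp: l0 lecture_hall_face_def zero_le_divide_iff)
    next
      case False
      have "m \<le> b" using m(1)[OF False] insert.hyps by auto
      then have "p $ m / s m \<le> p $ b / s b" using p m(1)[OF False] by (auto simp: lecture_hall_face_def)
      then have "s b * (p $ m / s m) \<le> s b * (p $ b / s b)" using pos' by (intro mult_left_mono) auto
      then show ?thesis using pos'[of b] pi[OF ne[OF m(1)[OF False]]] by (simp add: l[OF False])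
    qed
    moreover have "p $ b \<le> u (proj p)" using p pos'[of b] by (auto simp: lecture_hall_face_def u_def)
    ultimately show "p \<in> region" unfolding region_def using lift_proj[of p] by force
  qed
  then show ?case using unimodular_complex_region by metis
qed

theorem theorem3p3:
  fixes s :: "'d::{finite,linorder} \<Rightarrow> nat"
  assumes "\<And>i. s i > 0"
    and "mono s"
    and "\<And>i j. i < j \<Longrightarrow> {i<..<j} = {} \<Longrightarrow> \<exists>k::nat. k > 0 \<and> s j = k * s i"
  shows "\<exists>\<T>. unimodular_triangulation \<T> (lecture_hall_polytope s)"
proof -
  have "s i dvd s j" if "i < j" for i j
    by (rule dvd_if_dvd_successor[OF _ that]) (use assms(3) in force)
  then obtain T where "unimodular_complex UNIV T (lecture_hall_face s UNIV)"
    using lecture_hall_face_complex assms(1) by metis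
  moreover have "lecture_hall_face s UNIV = lecture_hall_polytope s"
    by (auto simp: lecture_hall_face_def lecture_hall_polytope_def)
  ultimately show ?thesis using unimodular_triangulation_if_complex by metis
qed

end
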